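(* Let $q$ be a prime power, and let $\mathcal{C}$ be a $q$-ary locally repairable code with disjoint local repair groups and parameters $(n=L(r+1),\,k=Lr-u,\,d,\,r)_q$, where $d\geq 7$. Then $$k\leq \frac{rn}{r+1}-\left\lceil\log_q\Big(q+(q-1)q\big(\tfrac{r}{2}n-r\big)\Big)\right\rceil .$$
   Context: Here $n,k,d,r$ are positive integers. A $q$-ary $[n,k,d]$ linear code $\mathcal{C}\subseteq\mathbb{F}_q^n$ (length $n$, dimension $k$, minimum Hamming distance $d$) is a locally repairable code (LRC) with locality $r$, with parameters denoted $(n,k,d,r)_q$, if for every $i\in[n]=\{1,\dots,n\}$ there are a set $R_i\subseteq[n]\setminus\{i\}$ with $|R_i|\le r$ and fixed nonzero elements $k_j\in\mathbb{F}_q\setminus\{0\}$ ($j\in R_i$) such that $c_i=\sum_{j\in R_i}k_jc_j$ for every codeword $(c_1,\dots,c_n)\in\mathcal{C}$. Such a set $R_i\cup\{i\}$ is called a local repair group. $\mathcal{C}$ has disjoint local repair groups if some local repair groups form a partition of $[n]$ and each of them has cardinality $r+1$. Then $(r+1)\mid n$, and $L=n/(r+1)$ is the number of groups. *)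

theory Defs
  imports "HOL-Analysis.Analysis"
begin

text \<open>
  A code over \<open>'a\<close> (the finite field with \<open>CARD('a)\<close> elements) is a set of vectors whose
  coordinate positions are the elements of a finite type \<open>'n\<close>; the length is \<open>CARD('n)\<close>.
\<close>

definition hamming_dist :: "'a ^ 'n \<Rightarrow> 'a ^ 'n \<Rightarrow> nat" where
  "hamming_dist x y = card {i. x $ i \<noteq> y $ i}"

text \<open>Meaningful only for codes with at least two codewords; otherwise the set is empty.\<close>

definition min_dist :: "('a ^ 'n) set \<Rightarrow> nat" where
  "min_dist C = Min {hamming_dist x y | x y. x \<in> C \<and> y \<in> C \<and> x \<noteq> y}"

definition linear_code :: "nat \<Rightarrow> nat \<Rightarrow> nat \<Rightarrow> nat \<Rightarrow> ('a::{field,finite} ^ 'n) set \<Rightarrow> bool" where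
  "linear_code q n k d C \<longleftrightarrow>
     CARD('a) = q \<and> CARD('n) = n \<and> vec.subspace C \<and> vec.dim C = k \<and> min_dist C = d"

definition repair_set :: "nat \<Rightarrow> ('a::field ^ 'n) set \<Rightarrow> 'n \<Rightarrow> 'n set \<Rightarrow> bool" where
  "repair_set r C i R \<longleftrightarrow>
     i \<notin> R \<and> card R \<le> r \<and>
     (\<exists>\<kappa>. (\<forall>j\<in>R. \<kappa> j \<noteq> 0) \<and> (\<forall>c\<in>C. c $ i = (\<Sum>j\<in>R. \<kappa> j * c $ j)))"

definition local_repair_group :: "nat \<Rightarrow> ('a::field ^ 'n) set \<Rightarrow> 'n set \<Rightarrow> bool" where
  "local_repair_group r C G \<longleftrightarrow> (\<exists>i R. repair_set r C i R \<and> G = insert i R)"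

definition lrc :: "nat \<Rightarrow> nat \<Rightarrow> nat \<Rightarrow> nat \<Rightarrow> nat \<Rightarrow> ('a::{field,finite} ^ 'n) set \<Rightarrow> bool" where
  "lrc q n k d r C \<longleftrightarrow> linear_code q n k d C \<and> (\<forall>i. \<exists>R. repair_set r C i R)"

definition disjoint_repair_groups :: "nat \<Rightarrow> ('a::field ^ 'n) set \<Rightarrow> bool" where
  "disjoint_repair_groups r C \<longleftrightarrow>
     (\<exists>P. partition_on UNIV P \<and> (\<forall>G\<in>P. local_repair_group r C G \<and> card G = r + 1))"

end

theory Submission
  imports Defs
begin

text \<open>
  The \<open>L\<close> local parity checks cut out a space \<open>V \<supseteq> C\<close> with at most \<open>q ^ (L * r)\<close> elements.
  Fix a coordinate \<open>j\<close> and a vector \<open>e \<in> V\<close> of weight 2 with \<open>e $ j = 1\<close>. The vectors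
  \<open>a *s e + v\<close>, where \<open>v \<in> V\<close> is zero or has as support a pair inside a repair group that
  avoids \<open>j\<close>, are pairwise distinct and differ in at most \<open>6 < d\<close> positions, so they lie in
  different cosets of \<open>C\<close>. There are \<open>q * (1 + (q - 1) * (r * n / 2 - r))\<close> of them, because
  \<open>r\<close> of the \<open>r * n / 2\<close> pairs contain \<open>j\<close>.
\<close>

section \<open>Sizes of subspaces over a finite field\<close>

lemma vec_card_span:
  fixes B :: "('a::{field,finite} ^ 'n) set"
  assumes "vec.independent B"
  shows "card (vec.span B) = CARD('a) ^ card B"
proof -
  have "finite B" by simp
  then show ?thesis using assms
  proof (induction B rule: finite_induct)
    case empty
    then show ?case by simp
  next
    case (insert b B)
    have b: "b \<notin> vec.span B" and B: "vec.independent B"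
      using insert.prems insert.hyps by (auto simp: vec.independent_insert)
    \<comment> \<open>Each new basis vector multiplies the size by \<open>CARD('a)\<close>: two
      representations with different coefficients of \<open>b\<close> would, after dividing by their
      difference, put \<open>b\<close> into the span of \<open>B\<close>.\<close>
    have "inj_on (\<lambda>(a, x). a *s b + x) (UNIV \<times> vec.span B)"
    proof (rule inj_onI, clarify)
      fix a x a' x'
      assume x: "x \<in> vec.span B" "x' \<in> vec.span B" and eq: "a *s b + x = a' *s b + x'"
      have "(a - a') *s b = x' - x"
        using eq by (simp add: vec.scale_left_diff_distrib algebra_simps)
      then have "(a - a') *s b \<in> vec.span B"
        using x by (simp add: vec.span_diff)
      then have "inverse (a - a') *s ((a - a') *s b) \<in> vec.span B"
        by (rule vec.span_scale)
      then have "a = a'"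
        using b by (cases "a = a'") (simp_all only: vec.scale_scale left_inverse right_minus_eq not_False_eq_True vec.scale_one)
      with eq show "a = a' \<and> x = x'" by simp
    qed
    moreover have "vec.span (insert b B) = (\<lambda>(a, x). a *s b + x) ` (UNIV \<times> vec.span B)"
    proof -
      have "x \<in> (\<lambda>(a, x). a *s b + x) ` (UNIV \<times> vec.span B)" if "x - a *s b \<in> vec.span B" for x a
        using that by (intro image_eqI[of _ _ "(a, x - a *s b)"]) auto
      moreover have "\<exists>k. a *s b + x - k *s b \<in> vec.span B" if "x \<in> vec.span B" for x a
        using that by (intro exI[of _ a]) simp
      ultimately show ?thesis by (auto simp: vec.span_insert)
    qed
    ultimately show ?case
      using insert B by (simp add: card_image card_cartesian_product)
  qed
qed

lemma card_vec_subspace: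
  fixes C :: "('a::{field,finite} ^ 'n) set"
  assumes "vec.subspace C"
  shows "card C = CARD('a) ^ vec.dim C"
proof -
  obtain B where B: "B \<subseteq> C" "vec.independent B" "C \<subseteq> vec.span B" "card B = vec.dim C"
    using vec.basis_exists by blast
  then have "vec.span B = C" using assms vec.span_minimal by blast
  with vec_card_span[OF B(2)] B(4) show ?thesis by simp
qed

lemma min_dist_le:
  fixes C :: "('a::finite ^ 'n) set"
  assumes "x \<in> C" "y \<in> C" "x \<noteq> y"
  shows "min_dist C \<le> hamming_dist x y"
  unfolding min_dist_def
proof (rule Min_le)
  show "finite {hamming_dist x y |x y. x \<in> C \<and> y \<in> C \<and> x \<noteq> y}"
    by (rule finite_subset[OF _ finite_image_set2[of "\<lambda>x. x \<in> C" "\<lambda>y. y \<in> C" hamming_dist]])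
      auto
qed (use assms in auto)

section \<open>Local parity checks and the space they cut out\<close>

lemma local_repair_group_parity_check:
  fixes C :: "('a::field ^ 'n) set"
  assumes "local_repair_group r C G"
  obtains h where "\<And>l. h l \<noteq> 0" "\<And>c. c \<in> C \<Longrightarrow> (\<Sum>l\<in>G. h l * c $ l) = 0"
proof -
  obtain i R \<kappa> where i: "i \<notin> R" "G = insert i R" and \<kappa>: "\<forall>j\<in>R. \<kappa> j \<noteq> 0"
    and c: "\<forall>c\<in>C. c $ i = (\<Sum>j\<in>R. \<kappa> j * c $ j)"
    using assms unfolding local_repair_group_def repair_set_def by auto
  \<comment> \<open>The value \<open>- 1\<close> is the coefficient of \<open>c $ i\<close> once it
    is moved to the other side; as a default off \<open>G\<close> it keeps \<open>h\<close> nonzero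
    everywhere.\<close>
  let ?h = "\<lambda>l. if l \<in> R then \<kappa> l else - 1"
  show thesis
  proof
    show "?h l \<noteq> 0" for l using \<kappa> by auto
    show "(\<Sum>l\<in>G. ?h l * c $ l) = 0" if "c \<in> C" for c
      using i c that by simp
  qed
qed

text \<open>Every coordinate lies in exactly one group, so the coefficients of the separate checks
  glue to a single function.\<close>

lemma partition_parity_checks:
  fixes C :: "('a::field ^ 'n) set"
  assumes "partition_on UNIV P" "\<And>G. G \<in> P \<Longrightarrow> local_repair_group r C G"
  obtains h where "\<And>l. h l \<noteq> 0"
    "\<And>G c. G \<in> P \<Longrightarrow> c \<in> C \<Longrightarrow> (\<Sum>l\<in>G. h l * c $ l) = 0"
proof -
  have "\<forall>G\<in>P. \<exists>h. (\<forall>l. h l \<noteq> 0) \<and> (\<forall>c\<in>C. (\<Sum>l\<in>G. h l * c $ l) = 0)"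
    using assms(2) local_repair_group_parity_check by metis
  then obtain H where H: "\<And>G l. G \<in> P \<Longrightarrow> H G l \<noteq> 0"
    "\<And>G c. G \<in> P \<Longrightarrow> c \<in> C \<Longrightarrow> (\<Sum>l\<in>G. H G l * c $ l) = 0"
    by metis
  have "\<forall>l. \<exists>G. G \<in> P \<and> l \<in> G" using assms(1) by (auto simp: partition_on_def)
  then obtain g where g: "\<And>l. g l \<in> P" "\<And>l. l \<in> g l" by metis
  have gG: "g l = G" if "G \<in> P" "l \<in> G" for l G
    using that g assms(1) by (meson disjointD disjoint_iff partition_onD2)
  show thesis
  proof
    show "H (g l) l \<noteq> 0" for l using H(1) g by blast
    show "(\<Sum>l\<in>G. H (g l) l * c $ l) = 0" if "G \<in> P" "c \<in> C" for G c
      using H(2)[OF that] gG[OF that(1)] by simp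
  qed
qed

definition parity_space :: "('n \<Rightarrow> 'a::field) \<Rightarrow> 'n set set \<Rightarrow> ('a ^ 'n) set" where
  "parity_space h P = {x. \<forall>G\<in>P. (\<Sum>l\<in>G. h l * x $ l) = 0}"

lemma subspace_parity_space:
  fixes h :: "'n::finite \<Rightarrow> 'a::field"
  shows "vec.subspace (parity_space h P)"
proof -
  have *: "(\<Sum>l\<in>G. h l * (c * x $ l)) = c * (\<Sum>l\<in>G. h l * x $ l)" for c and x :: "'a ^ 'n" and G
    by (simp add: sum_distrib_left mult.left_commute)
  show ?thesis
    by (auto simp: vec.subspace_def parity_space_def * distrib_left sum.distrib)
qed

text \<open>In each group one chosen coordinate is determined by the others, since its coefficient
  is invertible. A vector is therefore fixed by its values off a system of representatives of
  \<open>P\<close>.\<close>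

lemma card_parity_space_le:
  fixes h :: "'n::finite \<Rightarrow> 'a::{field,finite}"
  assumes P: "partition_on UNIV P" and h: "\<And>l. h l \<noteq> 0"
  shows "card (parity_space h P) \<le> CARD('a) ^ (CARD('n) - card P)"
proof -
  have "\<forall>G\<in>P. \<exists>l. l \<in> G" using partition_onD3[OF P] by (metis all_not_in_conv)
  then obtain p where p: "\<And>G. G \<in> P \<Longrightarrow> p G \<in> G" by metis
  have disj: "G = G'" if "G \<in> P" "G' \<in> P" "l \<in> G" "l \<in> G'" for G G' l
    using that P by (meson disjointD disjoint_iff partition_onD2)
  have "inj_on p P" using p disj by (metis inj_onI)
  define I where "I = UNIV - p ` P"
  have cI: "card I = CARD('n) - card P"
    using card_image[OF \<open>inj_on p P\<close>] by (simp add: I_def card_Diff_subset)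
  have "inj_on (\<lambda>x. restrict (($) x) I) (parity_space h P)"
  proof (rule inj_onI)
    fix x y assume x: "x \<in> parity_space h P" and y: "y \<in> parity_space h P"
      and eq: "restrict (($) x) I = restrict (($) y) I"
    have I: "x $ l = y $ l" if "l \<in> I" for l using fun_cong[OF eq, of l] that by simp
    have "x $ p G = y $ p G" if G: "G \<in> P" for G
    proof -
      have "l \<in> I" if "l \<in> G - {p G}" for l
        using that G p disj by (auto simp: I_def) 
      then have "(\<Sum>l\<in>G - {p G}. h l * x $ l) = (\<Sum>l\<in>G - {p G}. h l * y $ l)"
        using I by (intro sum.cong) auto
      moreover have "(\<Sum>l\<in>G. h l * x $ l) = (\<Sum>l\<in>G. h l * y $ l)"
        using x y G by (simp add: parity_space_def)
      ultimately show ?thesis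
        using h[of "p G"] p[OF G] by (simp add: sum.remove[of G "p G"])
    qed
    then have "x $ l = y $ l" for l using I by (cases "l \<in> p ` P") (auto simp: I_def)
    then show "x = y" by (simp add: vec_eq_iff)
  qed
  then have "card (parity_space h P) \<le> card (I \<rightarrow>\<^sub>E (UNIV :: 'a set))"
    by (rule card_inj_on_le) (auto intro: finite_PiE)
  then show ?thesis by (simp add: card_PiE cI)
qed

section \<open>Vectors supported on a pair inside a group\<close>

definition pair_vec :: "('n::finite \<Rightarrow> 'a::field) \<Rightarrow> 'n \<Rightarrow> 'n \<Rightarrow> 'a \<Rightarrow> 'a ^ 'n" where
  "pair_vec h x y a = (\<chi> l. if l = x then a / h x else if l = y then - a / h y else 0)"

lemma pair_vec_in_parity_space:
  fixes h :: "'n::finite \<Rightarrow> 'a::field"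
  assumes P: "partition_on UNIV P" and h: "\<And>l. h l \<noteq> 0"
    and G: "G \<in> P" "x \<in> G" "y \<in> G" "x \<noteq> y"
  shows "pair_vec h x y a \<in> parity_space h P"
  unfolding parity_space_def
proof clarify
  fix G' assume G': "G' \<in> P"
  have *: "h l * pair_vec h x y a $ l = (if l = x then a else 0) + (if l = y then - a else 0)" for l
    using h G(4) by (simp add: pair_vec_def)
  \<comment> \<open>A group contains both positions, where the terms \<open>a\<close> and
    \<open>- a\<close> cancel, or neither.\<close>
  have "x \<in> G' \<longleftrightarrow> y \<in> G'"
    using G G' P by (metis disjointD disjoint_iff partition_onD2)
  then show "(\<Sum>l\<in>G'. h l * pair_vec h x y a $ l) = 0"
    unfolding * by (simp add: sum.distrib)
qed

text \<open>These are the supports of the nonzero light vectors. Avoiding \<open>j\<close> leaves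
  that coordinate free to reveal the multiple of \<open>e\<close>.\<close>

definition inner_pairs :: "'n set set \<Rightarrow> 'n \<Rightarrow> 'n set set" where
  "inner_pairs P j = {D. card D = 2 \<and> j \<notin> D \<and> (\<exists>G\<in>P. D \<subseteq> G)}"

text \<open>Only the group of \<open>j\<close> loses pairs, namely the \<open>r\<close> that contain
  \<open>j\<close>. Adding \<open>r\<close> on the left avoids subtraction on naturals.\<close>

lemma card_inner_pairs:
  fixes P :: "'n::finite set set"
  assumes P: "partition_on UNIV P" and card: "\<And>G. G \<in> P \<Longrightarrow> card G = r + 1"
  shows "card (inner_pairs P j) + r = card P * ((r + 1) choose 2)"
proof -
  define F where "F G = {D. D \<subseteq> G - {j} \<and> card D = 2}" for G
  have disj: "G = G'" if "G \<in> P" "G' \<in> P" "l \<in> G" "l \<in> G'" for G G' l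
    using that P by (meson disjointD disjoint_iff partition_onD2)
  obtain G0 where G0: "G0 \<in> P" "j \<in> G0" using partition_onD1[OF P] by blast
  have cF: "card (F G) = (if G = G0 then r choose 2 else (r + 1) choose 2)" if "G \<in> P" for G
  proof -
    have "j \<in> G \<longleftrightarrow> G = G0" using that G0 disj by blast
    then have "card (G - {j}) = (if G = G0 then r else r + 1)"
      using card[OF that] by (cases "G = G0") simp_all
    then show ?thesis using n_subsets[of "G - {j}" 2] by (simp add: F_def)
  qed
  have "inner_pairs P j = (\<Union>G\<in>P. F G)"
    by (auto simp: inner_pairs_def F_def)
  also have "card \<dots> = (\<Sum>G\<in>P. card (F G))"
  proof (rule card_UN_disjoint)
    show "\<forall>G\<in>P. \<forall>G'\<in>P. G \<noteq> G' \<longrightarrow> F G \<inter> F G' = {}"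
    proof (intro ballI impI)
      fix G G' assume G: "G \<in> P" "G' \<in> P" "G \<noteq> G'"
      have False if D: "D \<in> F G" "D \<in> F G'" for D
      proof -
        obtain l where "l \<in> D" using D(1) by (fastforce simp: F_def)
        then have "l \<in> G" "l \<in> G'" using D by (auto simp: F_def)
        then show False using G disj by blast
      qed
      then show "F G \<inter> F G' = {}" by auto
    qed
  qed auto
  also have "\<dots> = (r choose 2) + (\<Sum>G\<in>P - {G0}. (r + 1) choose 2)"
    using G0(1) cF by (simp add: sum.remove[of P G0])
  also have "\<dots> + r = card P * ((r + 1) choose 2)"
  proof -
    \<comment> \<open>Pascal's rule restores the pairs through \<open>j\<close>.\<close>
    have "(r choose 2) + r = (r + 1) choose 2" by (simp add: numeral_2_eq_2)
    moreover have "card P = Suc (card (P - {G0}))"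
      using G0(1) by (metis card.remove finite)
    ultimately show ?thesis by simp
  qed
  finally show ?thesis by simp
qed

text \<open>\<open>T\<close> consists of 0 and, for each pair, one vector for each of the
  \<open>CARD('a) - 1\<close> nonzero scalars.\<close>

lemma light_vectors_exist:
  fixes h :: "'n::finite \<Rightarrow> 'a::{field,finite}"
  assumes P: "partition_on UNIV P" and h: "\<And>l. h l \<noteq> 0"
  obtains T where "T \<subseteq> parity_space h P" "card T = 1 + (CARD('a) - 1) * card (inner_pairs P j)"
    "\<forall>v\<in>T. v $ j = 0" "\<forall>v\<in>T. card {l. v $ l \<noteq> 0} \<le> 2"
proof -
  have "\<forall>D. \<exists>x y. D \<in> inner_pairs P j \<longrightarrow> x \<noteq> y \<and> D = {x, y}"
    by (auto simp: inner_pairs_def card_2_iff)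
  then obtain f g where fg: "\<And>D. D \<in> inner_pairs P j \<Longrightarrow> f D \<noteq> g D \<and> D = {f D, g D}"
    by metis
  define w where "w = (\<lambda>(D, a). pair_vec h (f D) (g D) a)"
  define A where "A = inner_pairs P j \<times> (UNIV - {0::'a})"
  define T where "T = insert 0 (w ` A)"
  have supp: "{l. w (D, a) $ l \<noteq> 0} = D" if "D \<in> inner_pairs P j" "a \<noteq> 0" for D a
    using fg[OF that(1)] that(2) h by (auto simp: w_def pair_vec_def)
  have j: "j \<notin> D" "card D = 2" if "D \<in> inner_pairs P j" for D
    using that by (auto simp: inner_pairs_def)
  \<comment> \<open>The support recovers the pair, and the entry at \<open>f D\<close> then recovers
    the scalar.\<close>
  have "inj_on w A"
  proof (rule inj_onI, clarify)
    fix D a D' a' assume A: "(D, a) \<in> A" "(D', a') \<in> A" and eq: "w (D, a) = w (D', a')"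
    have "D = D'" using supp[of D a] supp[of D' a'] A eq by (simp add: A_def)
    moreover have "w (D, a) $ f D = a / h (f D)" for D a by (simp add: w_def pair_vec_def)
    ultimately show "D = D' \<and> a = a'" using eq h by (metis divide_cancel_right)
  qed
  moreover have "0 \<notin> w ` A"
  proof
    assume "0 \<in> w ` A"
    then obtain D a where "(D, a) \<in> A" "w (D, a) = 0" by (metis imageE surj_pair)
    then have "D \<in> inner_pairs P j" "a \<noteq> 0" "w (D, a) = 0" by (auto simp: A_def)
    then show False using supp[of D a] j(2)[of D] by auto
  qed
  ultimately have "card T = 1 + card A" by (simp add: T_def card_image)
  then have "card T = 1 + (CARD('a) - 1) * card (inner_pairs P j)"
    by (simp add: A_def card_cartesian_product card_Diff_singleton)
  moreover have "T \<subseteq> parity_space h P"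
  proof -
    have "w (D, a) \<in> parity_space h P" if D: "D \<in> inner_pairs P j" for D a
    proof -
      obtain G where "G \<in> P" "D \<subseteq> G" using D unfolding inner_pairs_def by blast
      then show ?thesis
        using fg[OF D] pair_vec_in_parity_space[where h = h and a = a, OF P h, of G "f D" "g D"]
        unfolding w_def by auto
    qed
    then show ?thesis
      using vec.subspace_0[OF subspace_parity_space] by (auto simp: T_def A_def)
  qed
  moreover have "\<forall>v\<in>T. v $ j = 0" "\<forall>v\<in>T. card {l. v $ l \<noteq> 0} \<le> 2"
    using supp j by (fastforce simp: T_def A_def)+
  ultimately show thesis using that by blast
qed

section \<open>Disjoint cosets of the code and the final bound\<close>

lemma light_cosets_bound:
  fixes C :: "('a::{field,finite} ^ 'n) set"
  assumes C: "vec.subspace C" "min_dist C \<ge> 7" and r: "r > 0"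
    and P: "partition_on UNIV P"
    and G: "\<And>G. G \<in> P \<Longrightarrow> local_repair_group r C G" "\<And>G. G \<in> P \<Longrightarrow> card G = r + 1"
  shows "CARD('a) ^ vec.dim C * (CARD('a) * (1 + (CARD('a) - 1) * card (inner_pairs P j)))
    \<le> CARD('a) ^ (CARD('n) - card P)"
proof -
  obtain h where h: "\<And>l. h l \<noteq> 0"
    and hC: "\<And>G c. G \<in> P \<Longrightarrow> c \<in> C \<Longrightarrow> (\<Sum>l\<in>G. h l * c $ l) = 0"
    using partition_parity_checks[OF P G(1)] by blast
  let ?V = "parity_space h P"
  have CV: "C \<subseteq> ?V" using hC by (auto simp: parity_space_def)
  obtain T where T: "T \<subseteq> ?V" "card T = 1 + (CARD('a) - 1) * card (inner_pairs P j)"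
    "\<forall>v\<in>T. v $ j = 0" "\<forall>v\<in>T. card {l. v $ l \<noteq> 0} \<le> 2"
    by (rule light_vectors_exist[where h = h and j = j, OF P h])
  obtain G0 where G0: "G0 \<in> P" "j \<in> G0" using partition_onD1[OF P] by blast
  then have "card (G0 - {j}) = r" using G(2) by simp
  then have "G0 - {j} \<noteq> {}" using r by force
  then obtain i where i: "i \<in> G0" "i \<noteq> j" by auto
  \<comment> \<open>The scalar \<open>h j\<close> normalises the entry at \<open>j\<close> to
    1.\<close>
  define e where "e = pair_vec h j i (h j)"
  have eV: "e \<in> ?V" 
    unfolding e_def by (rule pair_vec_in_parity_space[OF P h G0 i(1) i(2)[symmetric]])
  have ej: "e $ j = 1" using h by (simp add: e_def pair_vec_def)
  have e0: "e $ l = 0" if "l \<notin> {i, j}" for l using that by (simp add: e_def pair_vec_def)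
  define m where "m = (\<lambda>(c, a, v). c + a *s e + v)"
  have "c = c' \<and> a = a' \<and> v = v'"
    if c: "c \<in> C" "c' \<in> C" and v: "v \<in> T" "v' \<in> T" and eq: "m (c, a, v) = m (c', a', v')"
    for c a v c' a' v'
  proof -
    have eql: "c $ l + a * e $ l + v $ l = c' $ l + a' * e $ l + v' $ l" for l
      using arg_cong[OF eq, of "\<lambda>x. x $ l"] by (simp add: m_def)
    \<comment> \<open>The multiples of \<open>e\<close>, \<open>v\<close> and \<open>v'\<close>
      contribute at most two positions each, so \<open>c\<close> and \<open>c'\<close> differ in at
      most 6 places, fewer than the minimum distance.\<close>
    let ?S = "{i, j} \<union> ({l. v $ l \<noteq> 0} \<union> {l. v' $ l \<noteq> 0})"
    have "c = c'"
    proof (rule ccontr)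
      assume "c \<noteq> c'"
      have "l \<in> ?S" if "c $ l \<noteq> c' $ l" for l
        using eql[of l] e0[of l] that by auto
      then have "hamming_dist c c' \<le> card ?S"
        unfolding hamming_dist_def by (intro card_mono) auto
      also have "\<dots> \<le> card {i, j} + (card {l. v $ l \<noteq> 0} + card {l. v' $ l \<noteq> 0})"
        by (meson add_left_mono card_Un_le order_trans)
      also have "\<dots> \<le> 6" using bspec[OF T(4) v(1)] bspec[OF T(4) v(2)] i(2) by simp
      finally show False using min_dist_le[OF c \<open>c \<noteq> c'\<close>] C(2) by simp
    qed
    \<comment> \<open>At \<open>j\<close> the vectors \<open>v\<close> and \<open>v'\<close> vanish
      and \<open>e\<close> is 1, so only \<open>a\<close> and \<open>a'\<close> remain.\<close>
    moreover have "a = a'" using eql[of j] T(3) v ej \<open>c = c'\<close> by simp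
    ultimately show ?thesis using eq by (simp add: m_def)
  qed
  then have "inj_on m (C \<times> UNIV \<times> T)" by (auto simp: inj_on_def)
  moreover have "m ` (C \<times> UNIV \<times> T) \<subseteq> ?V"
    using CV T(1) eV
    by (auto simp: m_def intro!: vec.subspace_add[OF subspace_parity_space]
        vec.subspace_scale[OF subspace_parity_space])
  ultimately have "card (C \<times> (UNIV :: 'a set) \<times> T) \<le> card ?V"
    by (rule card_inj_on_le) simp
  also have "\<dots> \<le> CARD('a) ^ (CARD('n) - card P)"
    by (rule card_parity_space_le[OF P h])
  finally show ?thesis
    by (simp add: card_cartesian_product card_vec_subspace[OF C(1)] T(2))
qed

theorem lemma3:
  fixes C :: "('a::{field,finite} ^ 'n) set"
    and q n k d r L :: nat and u :: int
  assumes "n > 0" and "k > 0" and "d > 0" and "r > 0"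
    and "lrc q n k d r C"
    and "disjoint_repair_groups r C"
    and "n = L * (r + 1)"
    and "int k = int L * int r - u"
    and "d \<ge> 7"
  shows "real k \<le> real r * real n / (real r + 1)
    - real_of_int \<lceil>log (real q) (real q + (real q - 1) * real q * (real r / 2 * real n - real r))\<rceil>"
proof -
  have C: "CARD('a) = q" "CARD('n) = n" "vec.subspace C" "vec.dim C = k" "min_dist C = d"
    using assms(5) by (auto simp: lrc_def linear_code_def)
  obtain P where P: "partition_on UNIV P"
    and G: "\<And>G. G \<in> P \<Longrightarrow> local_repair_group r C G" "\<And>G. G \<in> P \<Longrightarrow> card G = r + 1"
    using assms(6) unfolding disjoint_repair_groups_def by blast
  have "n = sum card P"
    using product_partition[OF P] C(2) by simp
  also have "\<dots> = card P * (r + 1)" using G(2) by simp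
  finally have L: "card P = L" using assms(7) by (simp del: mult_Suc_right)
  have q: "q > 1"
    using C(1) card_mono[of UNIV "{0, 1 :: 'a}"] by simp
  \<comment> \<open>Any coordinate serves as \<open>j\<close>, because the count does not depend on
    it.\<close>
  define N where "N = card (inner_pairs P undefined)"
  have "2 * ((r + 1) choose 2) = r * (r + 1)"
    by (simp add: choose_two)
  then have "2 * real ((r + 1) choose 2) = real r * (real r + 1)"
    by (metis of_nat_mult of_nat_numeral of_nat_add of_nat_1)
  then have choose: "real ((r + 1) choose 2) = real r * (real r + 1) / 2" by linarith
  have "real N + real r = real (card P * ((r + 1) choose 2))"
    unfolding N_def using card_inner_pairs[OF P G(2)] by (metis of_nat_add)
  also have "\<dots> = real L * (real r * (real r + 1) / 2)"
    by (simp only: L choose of_nat_mult)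
  finally have N: "real N = real r / 2 * real n - real r"
    using assms(7) by (simp add: algebra_simps)
  let ?M = "real q + (real q - 1) * real q * (real r / 2 * real n - real r)"
  \<comment> \<open>One dimension is lost per group: \<open>L * (r + 1) - L = L * r\<close>.\<close>
  have "CARD('n) - card P = L * r" using C(2) L assms(7) by simp
  then have "q ^ k * (q * (1 + (q - 1) * N)) \<le> q ^ (L * r)"
    using light_cosets_bound[OF C(3) _ assms(4) P G, of undefined] C assms(9) by (simp add: N_def)
  then have "real (q ^ k * (q * (1 + (q - 1) * N))) \<le> real (q ^ (L * r))"
    by (rule of_nat_mono)
  moreover have M: "?M = real (q * (1 + (q - 1) * N))"
  proof -
    have "real (q - 1) = real q - 1" using q by simp
    then show ?thesis
      unfolding N[symmetric] by (simp only: of_nat_mult of_nat_add of_nat_1) (simp add: algebra_simps)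
  qed
  ultimately have le: "real q ^ k * ?M \<le> real q ^ (L * r)"
    unfolding M by (simp only: of_nat_mult of_nat_power)
  have "?M > 0" unfolding M using q by (simp only: of_nat_0_less_iff) simp
  then have "log q (real q ^ k * ?M) = real k + log q ?M"
    using q by (simp add: log_mult)
  moreover have "log q (real q ^ k * ?M) \<le> log q (real q ^ (L * r))"
    using q \<open>?M > 0\<close> le by (subst log_le_cancel_iff) auto
  ultimately have "log q ?M \<le> real_of_int (int (L * r) - int k)"
    using q by simp
  \<comment> \<open>The right-hand side is an integer, so the bound on the logarithm passes to its
    ceiling.\<close>
  then have "\<lceil>log q ?M\<rceil> \<le> int (L * r) - int k" by (rule ceiling_le)
  then have "real_of_int \<lceil>log q ?M\<rceil> \<le> real L * real r - real k"
    by (metis of_int_diff of_int_le_iff of_int_of_nat_eq of_nat_mult)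
  moreover have "real r * real n / (real r + 1) = real L * real r"
    unfolding assms(7) by (simp add: field_simps)
  ultimately show ?thesis by simp
qed

end
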